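(* Let $B_1,B_2,C\subseteq\mathbb{N}$ be pairwise disjoint infinite sets with $\Delta(B_1)<\infty$, $\Delta(B_2)<\infty$ and $H_1(C)=\{0\}$. Assume further that either $\Delta(C)<\infty$ or $H_2(C)$ is countable. Then $A=B_1\cup B_2\cup C$ is strongly complete.
   Context: $\mathbb{N}=\{1,2,3,\ldots\}$ and $\mathbb{T}=\mathbb{R}/\mathbb{Z}$. $\|x\|$ denotes the distance from $x$ to the nearest integer. For $S\subseteq\mathbb{N}$, $$\Delta(S):=\sup_{s\in S}\Bigg(s-\sum_{t\in S,\ t<s}t\Bigg).$$ For $S\subseteq\mathbb{Z}$ and $q>0$, $$H_q(S):=\left\{\theta\in\mathbb{T}:\sum_{s\in S}\|s\theta\|^q<\infty\right\}.$$ A set $A\subseteq\mathbb{N}$ is complete if every sufficiently large positive integer is a sum of distinct elements of $A$, and strongly complete if $A\setminus B$ is complete for every finite subset $B\subseteq A$. "Countable" includes finite. *)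

theory Defs
  imports "HOL-Analysis.Analysis"
begin

text \<open>The circle group \<open>\<real> / \<int>\<close>.\<close>

quotient_type circle = real / "\<lambda>x y :: real. x - y \<in> \<int>"
proof (rule equivpI)
  show "reflp (\<lambda>x y :: real. x - y \<in> \<int>)"
    by (simp add: reflp_def)
  show "symp (\<lambda>x y :: real. x - y \<in> \<int>)"
    using Ints_minus by (fastforce intro: sympI)
  show "transp (\<lambda>x y :: real. x - y \<in> \<int>)"
    using Ints_add by (fastforce intro: transpI)
qed

instantiation circle :: ab_group_add
begin

lift_definition zero_circle :: circle is "0 :: real" .

lift_definition plus_circle :: "circle \<Rightarrow> circle \<Rightarrow> circle" is "(+) :: real \<Rightarrow> real \<Rightarrow> real"
  using Ints_add by (fastforce simp: algebra_simps)

lift_definition uminus_circle :: "circle \<Rightarrow> circle" is "uminus :: real \<Rightarrow> real"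
  using Ints_minus by fastforce

lift_definition minus_circle :: "circle \<Rightarrow> circle \<Rightarrow> circle" is "(-) :: real \<Rightarrow> real \<Rightarrow> real"
  using Ints_diff by (fastforce simp: algebra_simps)

instance
  by standard (transfer; simp add: algebra_simps)+

end

lift_definition int_mult :: "int \<Rightarrow> circle \<Rightarrow> circle" is "\<lambda>k x. of_int k * x :: real"
  by (simp only: right_diff_distrib [symmetric] Ints_mult Ints_of_int)

text \<open>The distance to the nearest integer.\<close>

lift_definition int_dist :: "circle \<Rightarrow> real" is "\<lambda>x :: real. \<bar>x - of_int (round x)\<bar>"
proof -
  fix x y :: real
  assume "x - y \<in> \<int>"
  then obtain k where k: "x = y + of_int k"
    by (auto elim!: Ints_cases simp: algebra_simps)
  have "round x = round y + k"
    unfolding round_def k by (metis add.commute add.left_commute floor_add_int)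
  then show "\<bar>x - of_int (round x)\<bar> = \<bar>y - of_int (round y)\<bar>"
    by (simp add: k)
qed

text \<open>The supremum is taken in the extended reals, so that it may be infinite.\<close>

definition Delta :: "nat set \<Rightarrow> ereal" where
  "Delta S = (SUP s\<in>S. ereal (real s - (\<Sum>t | t \<in> S \<and> t < s. real t)))"

text \<open>The summands are nonnegative, so summability over \<open>S\<close> means that the sum is finite.
  The definition is meant for \<open>q > 0\<close>; for such \<open>q\<close>, \<open>0 powr q = 0\<close> is the usual power.\<close>

definition H :: "real \<Rightarrow> int set \<Rightarrow> circle set" where
  "H q S = {\<theta>. (\<lambda>s. int_dist (int_mult s \<theta>) powr q) summable_on S}"

definition complete_set :: "nat set \<Rightarrow> bool" where
  "complete_set A \<longleftrightarrow>
     (\<exists>N. \<forall>n\<ge>N. \<exists>F. finite F \<and> F \<subseteq> A \<and> n = \<Sum>F)"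

definition strongly_complete :: "nat set \<Rightarrow> bool" where
  "strongly_complete A \<longleftrightarrow>
     (\<forall>B. finite B \<and> B \<subseteq> A \<longrightarrow> complete_set (A - B))"

end

theory Submission
  imports Defs "HOL-Probability.Helly_Selection"
begin

text \<open>
  Write \<open>FS(X)\<close> for the set of finite subset sums of \<open>X\<close> and \<open>\<parallel>x\<parallel>\<close> for the distance of
  \<open>x\<close> to the nearest integer.

  If \<open>X\<close> is infinite and \<open>Delta X\<close> is finite then \<open>FS(X)\<close> has bounded gaps (lemma
  \<open>gaps_subset_sums\<close>), and this survives the removal of finitely many elements.  Once
  \<open>FS(B2) + FS(C)\<close> contains an interval as long as the gaps of \<open>FS(B1)\<close>, translating that
  interval by \<open>FS(B1)\<close> covers every large integer.  So the task is to find arbitrarily long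
  intervals in \<open>E l = S + FS(C \<inter> {l<..})\<close>, where \<open>S\<close> consists of the sums of those elements
  of \<open>B2\<close> that have not been removed; of \<open>S\<close> only its positive upper density matters (lemma \<open>long_intervals_in_sumset\<close>).

  The sets \<open>E l\<close> decrease with \<open>l\<close>, so their upper densities \<open>d l\<close> converge to some \<open>D > 0\<close>.
  Let \<open>A k = E k \<inter> {..<N k}\<close>, with \<open>N k\<close> a scale at which the upper density of \<open>E k\<close> is nearly
  attained.  For \<open>n \<in> FS(C \<inter> {l<..})\<close> and large \<open>k\<close>, both \<open>A k\<close> and its translate by \<open>n\<close> lie
  in \<open>E l\<close>; at the scale \<open>N k\<close> they have density about \<open>D\<close> and \<open>E l\<close> has density at most about
  \<open>d l\<close>, hence they overlap up to a proportion
  \<open>d l / D - 1\<close>, which tends to \<open>0\<close> as \<open>l\<close> grows.  The normalised overlaps of \<open>A k\<close>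
  with its translates are the Fourier coefficients of a probability measure on the circle, and a
  weak limit \<open>\<sigma>\<close> of these measures satisfies
  \<open>\<integral> cos (2 \<pi> n t) d\<sigma> \<ge> 1 - \<delta> l\<close> for all \<open>n \<in> FS(C \<inter> {l<..})\<close>, with \<open>\<delta> l \<longlonglongrightarrow> 0\<close>.  This
  is the situation of the locale \<open>rigid_spectrum\<close>.

  Such a \<open>\<sigma>\<close> is carried by a countable set.  If \<open>H 2 C\<close> is countable, averaging over all subset
  sums replaces the cosine by the product of the \<open>\<bar>cos (\<pi> c t)\<bar>\<close>, which vanishes outside
  \<open>H 2 C\<close> (lemma \<open>AE_square_summable\<close>).  If \<open>Delta C\<close> is finite, the sums
  \<open>n \<in> FS(C \<inter> {l<..})\<close> have bounded gaps, so the Fourier coefficients of the atomless part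
  of \<open>\<sigma>\<close> are large with positive frequency unless that part is zero; Wiener's lemma
  says that their mean square is \<open>0\<close> (lemma \<open>AE_atom_of_gaps\<close>).  On the other hand, at an atom
  \<open>t\<close> every \<open>\<parallel>n t\<parallel>\<close> with \<open>n \<in> FS(C \<inter> {l<..})\<close> is small, which forces \<open>t \<in> H 1 C\<close>
  (lemma \<open>summable_at_atom\<close>); so all atoms are integers.

  Hence \<open>\<sigma>\<close> is carried by the integers, all its Fourier coefficients are \<open>1\<close>, and along a
  subsequence \<open>A k\<close> is asymptotically invariant under every fixed translation.  A set that loses less
  than a proportion \<open>1 / L\<close> under each of \<open>L\<close> translations by \<open>0, ..., L - 1\<close> contains a point
  that survives all of them, that is, an interval of length \<open>L\<close>.
\<close>

section \<open>Subset sums and bounded gaps\<close>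

definition subset_sums :: "nat set \<Rightarrow> nat set" where
  "subset_sums X = {\<Sum>F | F. finite F \<and> F \<subseteq> X}"

lemma subset_sumsI: "finite F \<Longrightarrow> F \<subseteq> X \<Longrightarrow> \<Sum>F \<in> subset_sums X"
  unfolding subset_sums_def by blast

lemma subset_sumsE:
  assumes "n \<in> subset_sums X"
  obtains F where "finite F" "F \<subseteq> X" "n = \<Sum>F"
  using assms unfolding subset_sums_def by blast

lemma subset_sums_mono: "X \<subseteq> Y \<Longrightarrow> subset_sums X \<subseteq> subset_sums Y"
  unfolding subset_sums_def by blast

lemma zero_in_subset_sums: "0 \<in> subset_sums X"
  using subset_sumsI[of "{}" X] by simp

lemma add_in_subset_sums:
  assumes "m \<in> subset_sums X" "n \<in> subset_sums Y" "X \<inter> Y = {}"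
  shows "m + n \<in> subset_sums (X \<union> Y)"
proof -
  obtain F where F: "finite F" "F \<subseteq> X" "m = \<Sum>F" using assms(1) by (rule subset_sumsE)
  obtain G where G: "finite G" "G \<subseteq> Y" "n = \<Sum>G" using assms(2) by (rule subset_sumsE)
  have "m + n = \<Sum>(F \<union> G)"
    using F G assms(3) by (subst sum.union_disjoint) auto
  then show ?thesis
    using F G by (metis Un_mono finite_UnI subset_sumsI)
qed

definition has_gaps_at_most :: "nat \<Rightarrow> nat set \<Rightarrow> bool" where
  "has_gaps_at_most M S \<longleftrightarrow> (\<forall>n. \<exists>s\<in>S. s \<le> n \<and> n < s + M)"

lemma has_gaps_at_mostE:
  assumes "has_gaps_at_most M S"
  obtains s where "s \<in> S" "s \<le> n" "n < s + M"
  using assms unfolding has_gaps_at_most_def by blast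

lemma has_gaps_at_most_pos: "has_gaps_at_most M S \<Longrightarrow> 0 < M"
  by (erule has_gaps_at_mostE[of _ _ 0]) auto

lemma has_gaps_at_most_card:
  assumes "has_gaps_at_most M S"
  shows "N \<le> card (S \<inter> {..<N}) * M"
proof -
  have "{..<N} \<subseteq> (\<Union>s\<in>S \<inter> {..<N}. {s..<s + M})"
  proof
    fix n assume n: "n \<in> {..<N}"
    obtain s where "s \<in> S" "s \<le> n" "n < s + M"
      using assms by (rule has_gaps_at_mostE)
    then show "n \<in> (\<Union>s\<in>S \<inter> {..<N}. {s..<s + M})" using n by auto
  qed
  then have "card {..<N} \<le> card (\<Union>s\<in>S \<inter> {..<N}. {s..<s + M})" by (intro card_mono) auto
  also have "\<dots> \<le> (\<Sum>s\<in>S \<inter> {..<N}. card {s..<s + M})" by (rule card_UN_le) simp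
  finally show ?thesis by simp
qed

text \<open>
  A new element \<open>m\<close> exceeds the total \<open>T m\<close> of the smaller ones by at most \<open>K\<close>.  So the translate
  by \<open>m\<close> of the sums reached so far, which have small gaps up to \<open>T m\<close>, starts before a large gap can open,
  and the sums now have small gaps up to \<open>T m + m\<close>.
\<close>

lemma gaps_subset_sums:
  fixes X :: "nat set"
  assumes inf: "infinite X"
    and le: "\<And>s. s \<in> X \<Longrightarrow> s \<le> K + (\<Sum>t | t \<in> X \<and> t < s. t)"
  shows "has_gaps_at_most (Suc K) (subset_sums X)"
proof -
  define T where "T m = (\<Sum>t | t \<in> X \<and> t < m. t)" for m :: nat
  have reach: "\<exists>f\<in>subset_sums {t\<in>X. t < m}. f \<le> n \<and> n < f + Suc K"
    if "n < T m + Suc K" for m n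
    using that
  proof (induction m arbitrary: n)
    case 0
    then show ?case
      using zero_in_subset_sums by (intro bexI[of _ 0]) (auto simp: T_def)
  next
    case (Suc m)
    have sub: "subset_sums {t\<in>X. t < m} \<subseteq> subset_sums {t\<in>X. t < Suc m}"
      by (intro subset_sums_mono) auto
    show ?case
    proof (cases "n < T m + Suc K")
      case True
      then show ?thesis using Suc.IH sub by blast
    next
      case False
      have m: "m \<in> X"
      proof (rule ccontr)
        assume "m \<notin> X"
        then have "{t. t \<in> X \<and> t < Suc m} = {t. t \<in> X \<and> t < m}"
          by (auto simp: less_Suc_eq)
        then show False using False Suc.prems by (simp add: T_def)
      qed
      have eq: "{t. t \<in> X \<and> t < Suc m} = insert m {t. t \<in> X \<and> t < m}"
        using m by (auto simp: less_Suc_eq)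
      have "T (Suc m) = m + T m"
        unfolding T_def eq by (subst sum.insert) auto
      moreover have "m \<le> K + T m" using le[OF m] by (simp add: T_def)
      ultimately have "n - m < T m + Suc K" "m \<le> n"
        using Suc.prems False by auto
      then obtain f where f: "f \<in> subset_sums {t\<in>X. t < m}" "f \<le> n - m" "n - m < f + Suc K"
        using Suc.IH by blast
      have "m \<in> subset_sums {m}" using subset_sumsI[of "{m}" "{m}"] by simp
      then have "f + m \<in> subset_sums ({t\<in>X. t < m} \<union> {m})"
        by (intro add_in_subset_sums[OF f(1)]) auto
      moreover have "{t\<in>X. t < m} \<union> {m} = {t\<in>X. t < Suc m}" using eq by auto
      ultimately have "f + m \<in> subset_sums {t\<in>X. t < Suc m}" by simp
      moreover have "f + m \<le> n" "n < f + m + Suc K" using f \<open>m \<le> n\<close> by linarith+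
      ultimately show ?thesis by blast
    qed
  qed
  show ?thesis
    unfolding has_gaps_at_most_def
  proof
    fix n
    obtain b where b: "b \<in> X" "n < b" using inf unfolding infinite_nat_iff_unbounded by blast
    have "b \<le> T (Suc b)"
      unfolding T_def by (rule member_le_sum) (use b in auto)
    then obtain f where "f \<in> subset_sums {t\<in>X. t < Suc b}" "f \<le> n" "n < f + Suc K"
      using reach[of n "Suc b"] b by auto
    moreover have "subset_sums {t\<in>X. t < Suc b} \<subseteq> subset_sums X"
      by (intro subset_sums_mono) auto
    ultimately show "\<exists>s\<in>subset_sums X. s \<le> n \<and> n < s + Suc K" by blast
  qed
qed

text \<open>
  Deleting a finite set lowers each partial sum by at most the total of that set, so the excess of
  an element over the smaller ones stays bounded.
\<close>

lemma gaps_subset_sums_diff: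
  fixes X D :: "nat set"
  assumes Delta: "Delta X < \<infinity>" and inf: "infinite X" and D: "finite D"
  obtains M where "has_gaps_at_most M (subset_sums (X - D))"
proof -
  obtain r :: nat where r: "Delta X < ereal (real r)"
    using Delta by (auto simp: less_PInf_Ex_of_nat)
  have "s \<le> (r + \<Sum>D) + (\<Sum>t | t \<in> X - D \<and> t < s. t)" if s: "s \<in> X - D" for s
  proof -
    have "ereal (real s - (\<Sum>t | t \<in> X \<and> t < s. real t)) \<le> Delta X"
      unfolding Delta_def by (rule SUP_upper) (use s in auto)
    then have "real s - (\<Sum>t | t \<in> X \<and> t < s. real t) \<le> real r"
      using r by (meson ereal_less_eq(3) less_imp_le order_trans)
    then have "real s \<le> real (r + (\<Sum>t | t \<in> X \<and> t < s. t))" by simp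
    then have 1: "s \<le> r + (\<Sum>t | t \<in> X \<and> t < s. t)" by linarith
    have "(\<Sum>t | t \<in> X \<and> t < s. t) \<le> \<Sum>(D \<union> {t. t \<in> X - D \<and> t < s})"
      by (rule sum_mono2) (use D in auto)
    also have "\<dots> = \<Sum>D + (\<Sum>t | t \<in> X - D \<and> t < s. t)"
      by (rule sum.union_disjoint) (use D in auto)
    finally show ?thesis using 1 by simp
  qed
  then show ?thesis
    using that gaps_subset_sums[of "X - D" "r + \<Sum>D"] inf D by auto
qed


section \<open>Distance to the nearest integer\<close>

definition nint_dist :: "real \<Rightarrow> real" where
  "nint_dist x = \<bar>x - of_int (round x)\<bar>"

lemma int_dist_mult_abs_circle:
  "int_dist (int_mult (int c) (abs_circle x)) = nint_dist (real c * x)"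
  by (simp add: int_mult.abs_eq int_dist.abs_eq nint_dist_def)

lemma abs_circle_in_H_iff:
  "abs_circle x \<in> H q (int ` X) \<longleftrightarrow> (\<lambda>c. nint_dist (real c * x) powr q) summable_on X"
  unfolding H_def
  by (simp add: summable_on_reindex int_dist_mult_abs_circle o_def)

lemma abs_circle_eq_0_iff: "abs_circle x = 0 \<longleftrightarrow> x \<in> \<int>"
  by (simp add: zero_circle_def circle.abs_eq_iff)

lemma countable_vimage_abs_circle:
  assumes "countable U"
  shows "countable (abs_circle -` U)"
proof -
  have "abs_circle -` U \<subseteq> (\<Union>u\<in>U. range (\<lambda>k::int. rep_circle u + of_int k))"
  proof
    fix x assume x: "x \<in> abs_circle -` U"
    have "abs_circle (rep_circle (abs_circle x)) = abs_circle x"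
      by (rule Quotient_abs_rep[OF Quotient_circle])
    then have "x - rep_circle (abs_circle x) \<in> \<int>"
      by (metis circle.abs_eq_iff)
    then obtain k where "x - rep_circle (abs_circle x) = of_int k" by (auto elim: Ints_cases)
    then have "x = rep_circle (abs_circle x) + of_int k" by simp
    then show "x \<in> (\<Union>u\<in>U. range (\<lambda>k::int. rep_circle u + of_int k))" using x by blast
  qed
  then show ?thesis
    by (rule countable_subset) (use assms in auto)
qed

lemma nint_dist_add_of_int: "nint_dist (y + of_int k) = nint_dist y"
proof -
  have "abs_circle (y + of_int k) = abs_circle y" by (simp add: circle.abs_eq_iff)
  then show ?thesis using int_dist.abs_eq by (metis nint_dist_def)
qed

lemma nint_dist_nonneg: "0 \<le> nint_dist x" by (simp add: nint_dist_def)

lemma nint_dist_le_half: "nint_dist x \<le> 1/2"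
  using of_int_round_abs_le[of x] by (simp add: nint_dist_def abs_minus_commute)

lemma nint_dist_eq_abs:
  assumes "\<bar>x\<bar> < 1/2"
  shows "nint_dist x = \<bar>x\<bar>"
  using round_unique'[of x 0] assms by (simp add: nint_dist_def)

text \<open>
  The constant \<open>4\<close> leaves ample room below the optimal \<open>8\<close>, so that a cubic Taylor estimate of the
  sine with \<open>3 < \<pi> < 3.2\<close> is enough.
\<close>

lemma cos_2pi_le: "4 * (nint_dist x)\<^sup>2 \<le> 1 - cos (2 * pi * x)"
proof -
  define r where "r = x - of_int (round x)"
  have r: "\<bar>r\<bar> \<le> 1/2" using nint_dist_le_half[of x] by (simp add: r_def nint_dist_def)
  have "cos (2 * pi * x) = cos (2 * pi * r + 2 * pi * of_int (round x))"
    by (simp add: r_def algebra_simps)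
  also have "\<dots> = cos (2 * (pi * r))"
    by (simp only: cos_add sin_int_2pin cos_int_2pin) (simp add: mult.assoc)
  also have "\<dots> = 1 - 2 * (sin (pi * r))\<^sup>2" by (rule cos_double_sin)
  finally have c: "1 - cos (2 * pi * x) = 2 * (sin (pi * r))\<^sup>2" by linarith
  have pi: "3 < pi" "pi < 3.2" using pi_approx by simp_all
  have x: "\<bar>pi * r\<bar> \<le> 1.6"
  proof -
    have "\<bar>pi * r\<bar> = pi * \<bar>r\<bar>" by (simp add: abs_mult)
    also have "\<dots> \<le> 3.2 * (1/2)" by (rule mult_mono) (use pi r in auto)
    finally show ?thesis by simp
  qed
  have "\<bar>sin (pi * r) - (\<Sum>m<3. sin_coeff m * (pi * r) ^ m)\<bar> \<le> inverse (fact 3) * \<bar>pi * r\<bar> ^ 3"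
    by (rule Maclaurin_sin_bound)
  also have "(\<Sum>m<3. sin_coeff m * (pi * r) ^ m) = pi * r"
    by (simp add: numeral_3_eq_3 sin_coeff_def)
  also have "inverse (fact 3) * \<bar>pi * r\<bar> ^ 3 = \<bar>pi * r\<bar> * (\<bar>pi * r\<bar>\<^sup>2 / 6)"
    by (simp add: fact_numeral power2_eq_square power3_eq_cube)
  also have "\<dots> \<le> \<bar>pi * r\<bar> * (1.6\<^sup>2 / 6)"
    by (intro mult_left_mono divide_right_mono power_mono x) auto
  finally have "\<bar>pi * r\<bar> / 2 \<le> \<bar>sin (pi * r)\<bar>"
    using abs_triangle_ineq2_sym[of "pi * r" "sin (pi * r)"] abs_ge_zero[of "sin (pi * r)"]
    unfolding abs_minus_commute[of "sin (pi * r)"] power2_eq_square by linarith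
  moreover have "\<bar>3 * r\<bar> \<le> \<bar>pi * r\<bar>"
    unfolding abs_mult using pi by (intro mult_right_mono) auto
  ultimately have "\<bar>3/2 * r\<bar> \<le> \<bar>sin (pi * r)\<bar>" by (simp add: abs_mult)
  then have "(3/2 * r)\<^sup>2 \<le> (sin (pi * r))\<^sup>2" by (rule abs_le_square_iff[THEN iffD1])
  moreover have "(nint_dist x)\<^sup>2 = r\<^sup>2" by (simp add: nint_dist_def r_def)
  moreover have "9 * r\<^sup>2 \<le> 4 * (sin (pi * r))\<^sup>2"
    using calculation(1) by (simp add: power_mult_distrib power_divide)
  ultimately show ?thesis unfolding c using zero_le_power2[of r] by linarith
qed

lemma abs_cos_pi_le: "\<bar>cos (pi * x)\<bar> \<le> exp (- (nint_dist x)\<^sup>2)"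
proof -
  have "(cos (pi * x))\<^sup>2 = (1 + cos (2 * (pi * x))) / 2"
    by (simp add: cos_double_cos)
  also have "\<dots> \<le> 1 + (- 2 * (nint_dist x)\<^sup>2)"
    using cos_2pi_le[of x] by (simp add: mult.assoc)
  also have "\<dots> \<le> exp (- 2 * (nint_dist x)\<^sup>2)" by (rule exp_ge_add_one_self)
  also have "\<dots> = (exp (- (nint_dist x)\<^sup>2))\<^sup>2"
    by (simp add: power2_eq_square flip: exp_add)
  finally have "\<bar>cos (pi * x)\<bar> \<le> \<bar>exp (- (nint_dist x)\<^sup>2)\<bar>"
    by (rule abs_le_square_iff[THEN iffD2])
  then show ?thesis by simp
qed

text \<open>
  The left side is the real part of the product of the \<open>1 + cis (2 \<pi> c x)\<close>.  This product is the
  Fourier transform of a random subset sum, up to the factor \<open>2 ^ card X\<close>,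
  and each of its factors has modulus \<open>2 \<bar>cos (\<pi> c x)\<bar>\<close>.
\<close>

lemma sum_cos_subset_sums_le:
  fixes X :: "nat set" and x :: real
  assumes "finite X"
  shows "(\<Sum>G\<in>Pow X. cos (2 * pi * real (\<Sum>G) * x)) \<le> 2 ^ card X * (\<Prod>c\<in>X. \<bar>cos (pi * (real c * x))\<bar>)"
proof -
  define a where "a c = 2 * pi * real c * x" for c
  have prod_cis: "(\<Prod>c\<in>G. cis (a c)) = cis (2 * pi * real (\<Sum>G) * x)" if "finite G" for G
    using that
    by (induction G rule: finite_induct) (auto simp: a_def cis_mult ring_distribs)
  have norm1: "norm (1 + cis (2 * u)) = 2 * \<bar>cos u\<bar>" for u
  proof -
    have "(norm (1 + cis (2 * u)))\<^sup>2 = (1 + cos (2 * u))\<^sup>2 + (sin (2 * u))\<^sup>2"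
      by (simp add: cmod_power2)
    also have "\<dots> = 2 * (1 + cos (2 * u))"
      using sin_cos_squared_add[of "2 * u"] by (simp only: power2_sum) simp
    also have "\<dots> = (2 * \<bar>cos u\<bar>)\<^sup>2"
      unfolding cos_double_cos by (simp add: power_mult_distrib)
    finally show ?thesis by (rule power2_eq_imp_eq) auto
  qed
  have "(\<Prod>c\<in>X. cis (a c) + 1) = (\<Sum>G\<in>Pow X. \<Prod>c\<in>G. cis (a c))"
    using prod_add[OF assms, of "\<lambda>c. cis (a c)" "\<lambda>_. 1"] by simp
  also have "\<dots> = (\<Sum>G\<in>Pow X. cis (2 * pi * real (\<Sum>G) * x))"
    by (intro sum.cong refl prod_cis) (use assms finite_subset in auto)
  finally have "(\<Sum>G\<in>Pow X. cos (2 * pi * real (\<Sum>G) * x)) = Re (\<Prod>c\<in>X. 1 + cis (a c))"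
    by (simp add: add.commute)
  also have "\<dots> \<le> norm (\<Prod>c\<in>X. 1 + cis (a c))" by (rule complex_Re_le_cmod)
  also have "\<dots> = (\<Prod>c\<in>X. 2 * \<bar>cos (pi * (real c * x))\<bar>)"
    unfolding prod_norm[symmetric]
    by (intro prod.cong refl) (use norm1 in \<open>simp add: a_def mult.assoc\<close>)
  also have "\<dots> = 2 ^ card X * (\<Prod>c\<in>X. \<bar>cos (pi * (real c * x))\<bar>)"
    by (simp add: prod.distrib)
  finally show ?thesis .
qed

text \<open>
  Let \<open>r c\<close> be the signed distance of \<open>c x\<close> to its nearest integer.  Adding one element at a time
  keeps the sum of the \<open>r c\<close> in absolute value at most \<open>1/6\<close>: each step leads to at most
  \<open>1/6 + 1/6 < 1/2\<close>, where the absolute value is the distance to the nearest integer, and this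
  is again at most \<open>1/6\<close>.  Splitting by sign then bounds the sum of the \<open>\<bar>r c\<bar>\<close>.
\<close>

lemma summable_nint_dist_of_subset_sums_small:
  fixes x :: real
  assumes small: "\<And>n. n \<in> subset_sums X \<Longrightarrow> nint_dist (real n * x) \<le> 1/6"
  shows "(\<lambda>c. nint_dist (real c * x)) summable_on X"
proof -
  define r where "r c = real c * x - of_int (round (real c * x))" for c :: nat
  have nd: "nint_dist (real c * x) = \<bar>r c\<bar>" for c by (simp add: nint_dist_def r_def)
  have sum_r: "\<bar>sum r G\<bar> \<le> 1/6" if "finite G" "G \<subseteq> X" for G
    using that
  proof (induction G rule: finite_induct)
    case (insert c G)
    have "\<bar>r c\<bar> \<le> 1/6"
      using small[of c] subset_sumsI[of "{c}" X] insert.prems by (simp add: nd)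
    moreover have "\<bar>sum r G\<bar> \<le> 1/6" using insert by simp
    ultimately have "\<bar>sum r (insert c G)\<bar> < 1/2"
      unfolding sum.insert[OF insert.hyps] by linarith
    then have "\<bar>sum r (insert c G)\<bar> = nint_dist (sum r (insert c G))"
      by (simp add: nint_dist_eq_abs)
    also have "\<dots> = nint_dist (sum r (insert c G) + of_int (\<Sum>d\<in>insert c G. round (real d * x)))"
      by (simp only: nint_dist_add_of_int)
    also have "sum r (insert c G) + of_int (\<Sum>d\<in>insert c G. round (real d * x))
        = real (\<Sum>(insert c G)) * x"
      unfolding r_def sum_subtractf of_int_sum of_nat_sum sum_distrib_right by simp
    also have "nint_dist \<dots> \<le> 1/6"
      by (rule small, rule subset_sumsI) (use insert in auto)
    finally show ?case .
  qed simp
  have "sum (\<lambda>c. nint_dist (real c * x)) G \<le> 1/3" if G: "finite G" "G \<subseteq> X" for G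
  proof -
    have "sum (\<lambda>c. nint_dist (real c * x)) G
        = (\<Sum>c\<in>{c\<in>G. 0 \<le> r c}. \<bar>r c\<bar>) + (\<Sum>c\<in>{c\<in>G. \<not> 0 \<le> r c}. \<bar>r c\<bar>)"
      unfolding nd by (subst sum.union_disjoint[symmetric]) (auto intro: sum.cong simp: G)
    also have "\<dots> = sum r {c\<in>G. 0 \<le> r c} - sum r {c\<in>G. \<not> 0 \<le> r c}"
      by (simp add: sum_negf[symmetric])
    also have "\<dots> \<le> 1/3"
      using sum_r[of "{c\<in>G. 0 \<le> r c}"] sum_r[of "{c\<in>G. \<not> 0 \<le> r c}"] G by fastforce
    finally show ?thesis .
  qed
  then show ?thesis
    by (intro nonneg_bounded_partial_sums_imp_summable_on[of _ _ "1/3"])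
       (auto simp: nint_dist_nonneg intro!: eventually_finite_subsets_at_top_weakI)
qed

lemma summable_on_tail_imp:
  fixes f :: "nat \<Rightarrow> real"
  assumes "f summable_on X \<inter> {l<..}"
  shows "f summable_on X"
proof -
  have "f summable_on (X \<inter> {..l})" by (rule summable_on_finite) auto
  then have "f summable_on (X \<inter> {..l} \<union> X \<inter> {l<..})"
    using assms by (rule summable_on_Un_disjoint) auto
  moreover have "X \<inter> {..l} \<union> X \<inter> {l<..} = X" by auto
  ultimately show ?thesis by simp
qed


section \<open>Spectral measures of sets of integers\<close>

lemma has_integral_cos_period:
  fixes m :: int
  shows "has_bochner_integral lborel (\<lambda>t::real. cos (2 * pi * of_int m * t) * indicator {0..1} t)
           (if m = 0 then 1 else 0)"
proof (cases "m = 0")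
  case True
  have "has_bochner_integral lborel (\<lambda>t::real. 1 * indicator {0..1} t) (1 - 0 :: real)"
    by (rule has_bochner_integral_FTC_Icc_real[where F = "\<lambda>t. t" and f = "\<lambda>_. 1"])
      (auto intro!: derivative_eq_intros)
  then show ?thesis using True by simp
next
  case False
  define a where "a = 2 * pi * of_int m"
  have a: "a \<noteq> 0" using False by (simp add: a_def)
  have "has_bochner_integral lborel (\<lambda>t::real. cos (a * t) * indicator {0..1} t)
          (sin (a * 1) / a - sin (a * 0) / a)"
    by (rule has_bochner_integral_FTC_Icc_real[where F = "\<lambda>t. sin (a * t) / a"])
      (auto intro!: derivative_eq_intros simp: a)
  then show ?thesis using False by (simp add: a_def sin_int_2pin)
qed

definition autocorrelation :: "nat set \<Rightarrow> nat \<Rightarrow> real" where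
  "autocorrelation A n = real (card {x\<in>A. x + n \<in> A}) / real (card A)"

text \<open>
  The density is \<open>\<bar>\<Sum>x\<in>A. cis (2 \<pi> x t)\<bar>\<^sup>2 / card A\<close> on the unit interval; its Fourier
  coefficients count the pairs in \<open>A\<close> with a given difference, relative to \<open>card A\<close>.
\<close>

lemma spectral_measure_finite_set:
  fixes A :: "nat set"
  assumes fin: "finite A" and ne: "A \<noteq> {}"
  obtains \<mu> where "real_distribution \<mu>" "measure \<mu> {0..1} = 1"
    "\<And>n. (\<integral>t. cos (2 * pi * real n * t) \<partial>\<mu>) = autocorrelation A n"
proof -
  define g :: "real \<Rightarrow> real" where
    "g t = ((\<Sum>x\<in>A. cos (2 * pi * real x * t))\<^sup>2 + (\<Sum>x\<in>A. sin (2 * pi * real x * t))\<^sup>2) / real (card A)" for t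
  have g0: "0 \<le> g t" for t by (simp add: g_def)
  have [measurable]: "g \<in> borel_measurable borel" unfolding g_def by measurable
  have expand: "g t * cos (2 * pi * real n * t) =
      (\<Sum>x\<in>A. \<Sum>y\<in>A. (cos (2 * pi * of_int (int x - int y + int n) * t)
         + cos (2 * pi * of_int (int x - int y - int n) * t)) / (2 * real (card A)))" for n t
  proof -
    have "(cos (2 * pi * real x * t) * cos (2 * pi * real y * t)
        + sin (2 * pi * real x * t) * sin (2 * pi * real y * t)) * cos (2 * pi * real n * t)
      = (cos (2 * pi * of_int (int x - int y + int n) * t)
         + cos (2 * pi * of_int (int x - int y - int n) * t)) / 2" for x y
    proof -
      have "2 * pi * of_int (int x - int y + int n) * t
          = (2 * pi * real x * t - 2 * pi * real y * t) + 2 * pi * real n * t"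
        "2 * pi * of_int (int x - int y - int n) * t
          = (2 * pi * real x * t - 2 * pi * real y * t) - 2 * pi * real n * t"
        by (simp_all add: algebra_simps)
      then show ?thesis by (simp only: cos_add cos_diff) simp
    qed
    then have "(\<Sum>x\<in>A. \<Sum>y\<in>A. (cos (2 * pi * of_int (int x - int y + int n) * t)
         + cos (2 * pi * of_int (int x - int y - int n) * t)) / 2)
      = (\<Sum>x\<in>A. \<Sum>y\<in>A. (cos (2 * pi * real x * t) * cos (2 * pi * real y * t)
        + sin (2 * pi * real x * t) * sin (2 * pi * real y * t)) * cos (2 * pi * real n * t))"
      by (simp only:)
    also have "\<dots> = ((\<Sum>x\<in>A. cos (2 * pi * real x * t))\<^sup>2 + (\<Sum>x\<in>A. sin (2 * pi * real x * t))\<^sup>2)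
        * cos (2 * pi * real n * t)"
      by (simp only: power2_eq_square sum_product flip: sum.distrib sum_distrib_right)
    also have "\<dots> = (g t * cos (2 * pi * real n * t)) * real (card A)"
      using fin ne by (simp add: g_def)
    finally have "(g t * cos (2 * pi * real n * t)) =
      (\<Sum>x\<in>A. \<Sum>y\<in>A. (cos (2 * pi * of_int (int x - int y + int n) * t)
         + cos (2 * pi * of_int (int x - int y - int n) * t)) / 2) / real (card A)"
      using fin ne by (simp add: field_simps)
    then show ?thesis by (simp only: sum_divide_distrib divide_divide_eq_left)
  qed
  have count1: "(\<Sum>x\<in>A. \<Sum>y\<in>A. (if int x - int y + int n = 0 then 1 else 0)) = real (card {x\<in>A. x + n \<in> A})" for n
  proof -
    have "(\<Sum>y\<in>A. (if int x - int y + int n = 0 then 1 else 0)) = (if x + n \<in> A then 1 else (0::real))" for x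
    proof -
      have "(\<Sum>y\<in>A. (if int x - int y + int n = 0 then 1 else (0::real))) = (\<Sum>y\<in>A. (if x + n = y then 1 else 0))"
        by (intro sum.cong refl if_cong) auto
      then show ?thesis using fin by simp
    qed
    then show ?thesis using fin by (simp add: sum.If_cases Int_def)
  qed
  have count2: "(\<Sum>x\<in>A. \<Sum>y\<in>A. (if int x - int y - int n = 0 then 1 else 0)) = real (card {x\<in>A. x + n \<in> A})" for n
    unfolding count1[symmetric] by (subst sum.swap) (intro sum.cong refl if_cong, auto)
  have "has_bochner_integral lborel (\<lambda>t. \<Sum>x\<in>A. \<Sum>y\<in>A. (cos (2 * pi * of_int (int x - int y + int n) * t) * indicator {0..1} t
         + cos (2 * pi * of_int (int x - int y - int n) * t) * indicator {0..1} t) / (2 * real (card A)))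
     (\<Sum>x\<in>A. \<Sum>y\<in>A. ((if int x - int y + int n = 0 then 1 else 0)
         + (if int x - int y - int n = 0 then 1 else 0)) / (2 * real (card A)))" for n
    by (intro has_bochner_integral_sum has_bochner_integral_divide_zero has_bochner_integral_add
        has_integral_cos_period)
  moreover have "(\<Sum>x\<in>A. \<Sum>y\<in>A. ((if int x - int y + int n = 0 then 1 else 0)
         + (if int x - int y - int n = 0 then 1 else 0)) / (2 * real (card A))) = autocorrelation A n" for n
    unfolding sum_divide_distrib[symmetric] sum.distrib count1 count2 autocorrelation_def by simp
  moreover have "(\<lambda>t. \<Sum>x\<in>A. \<Sum>y\<in>A. (cos (2 * pi * of_int (int x - int y + int n) * t) * indicator {0..1} t
         + cos (2 * pi * of_int (int x - int y - int n) * t) * indicator {0..1} t) / (2 * real (card A)))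
     = (\<lambda>t. g t * cos (2 * pi * real n * t) * indicator {0..1} t)" for n
    unfolding expand sum_distrib_right by (simp add: distrib_right)
  ultimately have int: "has_bochner_integral lborel (\<lambda>t. g t * cos (2 * pi * real n * t) * indicator {0..1} t)
      (autocorrelation A n)" for n
    by metis
  define h where "h t = g t * indicator {0..1} t" for t
  have [measurable]: "h \<in> borel_measurable borel" unfolding h_def by measurable
  have h0: "0 \<le> h t" for t by (simp add: h_def g0)
  have h1: "has_bochner_integral lborel h 1"
    using int[of 0] fin ne by (simp add: autocorrelation_def h_def[abs_def])
  define \<mu> where "\<mu> = density lborel (\<lambda>t. ennreal (h t))"
  have nn: "(\<integral>\<^sup>+t. ennreal (h t) \<partial>lborel) = 1"
    using h1 h0 by (subst nn_integral_eq_integral) (auto simp: has_bochner_integral_iff)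
  have prob: "prob_space \<mu>"
    by (rule prob_spaceI) (simp add: \<mu>_def emeasure_density nn)
  have "real_distribution \<mu>"
    unfolding real_distribution_def real_distribution_axioms_def
    using prob by (simp add: \<mu>_def)
  moreover have "measure \<mu> {0..1} = 1"
  proof -
    have "emeasure \<mu> {0..1} = (\<integral>\<^sup>+t. ennreal (h t) * indicator {0..1} t \<partial>lborel)"
      by (simp add: \<mu>_def emeasure_density)
    also have "\<dots> = (\<integral>\<^sup>+t. ennreal (h t) \<partial>lborel)"
      by (intro nn_integral_cong) (auto simp: h_def indicator_def)
    finally show ?thesis by (simp add: nn measure_def)
  qed
  moreover have "(\<integral>t. cos (2 * pi * real n * t) \<partial>\<mu>) = autocorrelation A n" for n
  proof -
    have "(\<integral>t. cos (2 * pi * real n * t) \<partial>\<mu>) = (\<integral>t. h t * cos (2 * pi * real n * t) \<partial>lborel)"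
      unfolding \<mu>_def by (subst integral_density) (auto simp: h0)
    also have "\<dots> = (\<integral>t. g t * cos (2 * pi * real n * t) * indicator {0..1} t \<partial>lborel)"
      by (intro Bochner_Integration.integral_cong) (auto simp: h_def)
    finally show ?thesis using int[of n] by (simp add: has_bochner_integral_iff)
  qed
  ultimately show thesis using that by blast
qed

text \<open>
  All spectral measures live on the unit interval, so Helly's theorem provides a weak limit.
\<close>

lemma limit_spectral_measure:
  fixes A :: "nat \<Rightarrow> nat set"
  assumes "\<And>k. finite (A k)" "\<And>k. A k \<noteq> {}"
  obtains r \<sigma> where "strict_mono r" "real_distribution \<sigma>"
    "\<And>n. (\<lambda>k. autocorrelation (A (r k)) n) \<longlonglongrightarrow> (\<integral>t. cos (2 * pi * real n * t) \<partial>\<sigma>)"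
proof -
  have "\<exists>\<mu>. real_distribution \<mu> \<and> measure \<mu> {0..1} = 1 \<and>
      (\<forall>n. (\<integral>t. cos (2 * pi * real n * t) \<partial>\<mu>) = autocorrelation (A k) n)" for k
    using spectral_measure_finite_set[OF assms(1)[of k] assms(2)[of k]] by metis
  then obtain \<mu> where \<mu>: "\<And>k. real_distribution (\<mu> k)" "\<And>k. measure (\<mu> k) {0..1} = 1"
      "\<And>k n. (\<integral>t. cos (2 * pi * real n * t) \<partial>\<mu> k) = autocorrelation (A k) n"
    by metis
  \<comment> \<open>Tightness is stated with half-open intervals, hence the lower end \<open>-1\<close>, which covers the point \<open>0\<close>.\<close>
  have "tight \<mu>"
    unfolding tight_def
  proof (intro conjI allI impI)
    fix \<epsilon> :: real assume "0 < \<epsilon>"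
    have "measure (\<mu> k) {-1<..1} > 1 - \<epsilon>" for k
    proof -
      interpret real_distribution "\<mu> k" by (rule \<mu>)
      have "measure (\<mu> k) {0..1} \<le> measure (\<mu> k) {-1<..1}"
        by (rule finite_measure_mono) auto
      then show ?thesis using \<mu>(2)[of k] \<open>0 < \<epsilon>\<close> by simp
    qed
    then show "\<exists>a b::real. a < b \<and> (\<forall>n. measure (\<mu> n) {a<..b} > 1 - \<epsilon>)"
      by (intro exI[of _ "-1"] exI[of _ 1]) auto
  qed (rule \<mu>)
  then obtain r \<sigma> where r: "strict_mono r" "real_distribution \<sigma>" "weak_conv_m (\<mu> \<circ> id \<circ> r) \<sigma>"
    using tight_imp_convergent_subsubsequence[OF _ strict_mono_id] by blast
  have "(\<lambda>k. \<integral>t. cos (2 * pi * real n * t) \<partial>\<mu> (r k)) \<longlonglongrightarrow> (\<integral>t. cos (2 * pi * real n * t) \<partial>\<sigma>)" for n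
  proof (rule weak_conv_imp_integral_bdd_continuous_conv[where B = 1])
    show "real_distribution (\<mu> (r k))" for k by (rule \<mu>)
    show "weak_conv_m (\<lambda>k. \<mu> (r k)) \<sigma>" using r(3) by (simp add: o_def)
  qed (auto intro: r)
  then show thesis using that r(1,2) unfolding \<mu>(3) by blast
qed

section \<open>Rigid spectral measures\<close>

text \<open>
  Multiplying by \<open>2 sin (\<pi> a)\<close> telescopes the sum, which is therefore bounded in \<open>N\<close>.
\<close>

lemma cos_average_tendsto_0:
  fixes a :: real
  assumes "a \<notin> \<int>"
  shows "(\<lambda>N. (\<Sum>n<N. cos (2 * pi * real n * a)) / real N) \<longlonglongrightarrow> 0"
proof -
  have s: "sin (pi * a) \<noteq> 0"
  proof
    assume "sin (pi * a) = 0"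
    then obtain i :: int where "pi * a = of_int i * pi" using sin_zero_iff_int2 by blast
    then have "a = of_int i" by simp
    then show False using assms by simp
  qed
  have tel: "2 * sin (pi * a) * (\<Sum>n<N. cos (2 * pi * real n * a))
      = sin (2 * pi * real N * a - pi * a) + sin (pi * a)" for N
  proof (induction N)
    case (Suc N)
    have e: "2 * pi * real (Suc N) * a - pi * a = 2 * pi * real N * a + pi * a"
      by (simp add: algebra_simps)
    have "2 * sin (pi * a) * cos (2 * pi * real N * a)
        = sin (2 * pi * real N * a + pi * a) - sin (2 * pi * real N * a - pi * a)"
      by (simp only: sin_add sin_diff) simp
    then show ?case unfolding e sum.lessThan_Suc distrib_left Suc.IH by simp
  qed simp
  have bound: "\<bar>\<Sum>n<N. cos (2 * pi * real n * a)\<bar> \<le> 1 / \<bar>sin (pi * a)\<bar>" for N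
  proof -
    have "\<bar>2 * sin (pi * a) * (\<Sum>n<N. cos (2 * pi * real n * a))\<bar> \<le> 2"
      unfolding tel using abs_sin_le_one[of "2 * pi * real N * a - pi * a"] abs_sin_le_one[of "pi * a"]
      by linarith
    then show ?thesis using s by (simp add: abs_mult field_simps)
  qed
  have "(\<lambda>N. (1 / \<bar>sin (pi * a)\<bar>) / real N) \<longlonglongrightarrow> 0"
    by (intro tendsto_divide_0[OF tendsto_const] filterlim_real_sequentially[THEN filterlim_at_top_imp_at_infinity])
  then show ?thesis
  proof (rule Lim_null_comparison[rotated], intro always_eventually allI)
    fix N
    show "norm ((\<Sum>n<N. cos (2 * pi * real n * a)) / real N) \<le> 1 / \<bar>sin (pi * a)\<bar> / real N"
      unfolding real_norm_def abs_divide abs_of_nat by (intro divide_right_mono bound) simp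
  qed
qed


text \<open>
  Translations by the subset sums of the tails of \<open>C\<close> act on \<open>L\<^sup>2(\<sigma>)\<close> as multiplication by
  \<open>cis (2 \<pi> n t)\<close>; the assumption says that they move the constant function \<open>1\<close> by an amount
  that tends to zero along the tails.
\<close>

locale rigid_spectrum = real_distribution \<sigma> for \<sigma> :: "real measure" +
  fixes C :: "nat set" and \<delta> :: "nat \<Rightarrow> real"
  assumes \<delta>_tendsto: "\<delta> \<longlonglongrightarrow> 0"
    and rigid: "\<And>l n. n \<in> subset_sums (C \<inter> {l<..}) \<Longrightarrow>
      1 - \<delta> l \<le> (\<integral>t. cos (2 * pi * real n * t) \<partial>\<sigma>)"
begin

lemma integrable_bounded:
  fixes f :: "real \<Rightarrow> real"
  assumes [measurable]: "f \<in> borel_measurable borel" and "\<And>t. \<bar>f t\<bar> \<le> B"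
  shows "integrable \<sigma> f"
  using assms(2) by (intro integrable_const_bound[of _ B]) auto

lemma integrable_cos: "integrable \<sigma> (\<lambda>t. cos (2 * pi * real n * t))"
  by (rule integrable_bounded[of _ 1]) auto

text \<open>
  Since \<open>1 - cos\<close> is nonnegative, rigidity passes from \<open>\<sigma>\<close> to its restriction to any Borel set.
\<close>

lemma indicator_cos_defect_le:
  assumes [measurable]: "V \<in> sets borel" and n: "n \<in> subset_sums (C \<inter> {l<..})"
  shows "measure \<sigma> V - (\<integral>t. indicator V t * cos (2 * pi * real n * t) \<partial>\<sigma>) \<le> \<delta> l"
proof -
  have i1: "integrable \<sigma> (\<lambda>t. indicator V t * cos (2 * pi * real n * t))"
    by (rule integrable_bounded[of _ 1]) (auto simp: indicator_def)
  have i2: "integrable \<sigma> (indicator V :: real \<Rightarrow> real)"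
    by (rule integrable_bounded[of "indicator V" 1]) (auto simp: indicator_def)
  have "measure \<sigma> V - (\<integral>t. indicator V t * cos (2 * pi * real n * t) \<partial>\<sigma>)
      = (\<integral>t. indicator V t - indicator V t * cos (2 * pi * real n * t) \<partial>\<sigma>)"
    using i1 i2 by simp
  also have "\<dots> \<le> (\<integral>t. 1 - cos (2 * pi * real n * t) \<partial>\<sigma>)"
    by (intro integral_mono Bochner_Integration.integrable_diff i1 i2 integrable_cos)
      (auto simp: indicator_def)
  also have "\<dots> = 1 - (\<integral>t. cos (2 * pi * real n * t) \<partial>\<sigma>)"
    using integrable_cos[of n] prob_space by simp
  also have "\<dots> \<le> \<delta> l" using rigid[OF n] by simp
  finally show ?thesis .
qed

text \<open>
  Rigidity restricted to the atom gives \<open>1 - cos (2 \<pi> n x) \<le> \<delta> l / \<sigma> {x}\<close>.  Once this is at most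
  \<open>1/9\<close>, the distance of \<open>n x\<close> to the nearest integer is at most \<open>1/6\<close> for all subset sums \<open>n\<close> of the tail.
\<close>

lemma summable_at_atom:
  assumes "measure \<sigma> {x} \<noteq> 0"
  shows "(\<lambda>c. nint_dist (real c * x)) summable_on C"
proof -
  define w where "w = measure \<sigma> {x}"
  have w: "0 < w" using assms by (simp add: w_def zero_less_measure_iff)
  then obtain l where l: "\<delta> l < w / 9"
    using order_tendstoD(2)[OF \<delta>_tendsto, of "w / 9"] by (auto simp: eventually_sequentially)
  have "nint_dist (real n * x) \<le> 1/6" if n: "n \<in> subset_sums (C \<inter> {l<..})" for n
  proof -
    have "(\<integral>t. indicator {x} t * cos (2 * pi * real n * t) \<partial>\<sigma>)
        = (\<integral>t. indicator {x} t * cos (2 * pi * real n * x) \<partial>\<sigma>)"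
      by (intro Bochner_Integration.integral_cong) (auto simp: indicator_def)
    also have "\<dots> = w * cos (2 * pi * real n * x)" by (simp add: w_def)
    finally have "w * (1 - cos (2 * pi * real n * x)) \<le> \<delta> l"
      using indicator_cos_defect_le[of "{x}", OF _ n] by (simp add: w_def algebra_simps)
    also have "\<dots> \<le> w * (1/9)" using l by simp
    finally have "1 - cos (2 * pi * real n * x) \<le> 1/9" using w by (simp only: mult_le_cancel_left_pos)
    then have "(nint_dist (real n * x))\<^sup>2 \<le> (1/6)\<^sup>2"
      using cos_2pi_le[of "real n * x"] by (simp add: mult.assoc power2_eq_square)
    then show ?thesis by (rule power2_le_imp_le) simp
  qed
  then show ?thesis by (intro summable_on_tail_imp[of _ C l] summable_nint_dist_of_subset_sums_small)
qed

lemma AE_Ints: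
  assumes U: "countable U" and AE_U: "AE t in \<sigma>. t \<in> U"
    and triv: "\<And>x. (\<lambda>c. nint_dist (real c * x)) summable_on C \<Longrightarrow> x \<in> \<int>"
  shows "AE t in \<sigma>. t \<in> \<int>"
proof -
  have "{x} \<in> null_sets \<sigma>" if "x \<in> U - \<int>" for x
    using summable_at_atom[of x] triv[of x] that by (auto simp: null_sets_def emeasure_eq_measure)
  then have "(\<Union>x\<in>U - \<int>. {x}) \<in> null_sets \<sigma>"
    using U by (intro null_sets_UN') auto
  then have "AE t in \<sigma>. t \<notin> U - \<int>" using AE_not_in by fastforce
  then show ?thesis using AE_U by eventually_elim auto
qed

text \<open>
  Averaging the rigidity bound over the subset sums of \<open>C \<inter> {l<..k}\<close> bounds the integral of
  \<open>P l k = (\<Prod>c. \<bar>cos (\<pi> c t)\<bar>)\<close> from below by \<open>1 - \<delta> l\<close>.  Where the squared distances are not summable,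
  \<open>P l k\<close> tends to zero as \<open>k\<close> grows, so the mass must lie in \<open>U\<close>.
\<close>

lemma AE_square_summable:
  defines "U \<equiv> {x. (\<lambda>c. (nint_dist (real c * x))\<^sup>2) summable_on C}"
  assumes "countable U"
  shows "AE t in \<sigma>. t \<in> U"
proof -
  have [measurable]: "U \<in> sets borel"
    using \<open>countable U\<close> by (rule sets.countable[rotated]) auto
  define P where "P l k t = (\<Prod>c\<in>C \<inter> {l<..k}. \<bar>cos (pi * (real c * t))\<bar>)" for l k t
  have [measurable]: "P l k \<in> borel_measurable borel" for l k
    unfolding P_def by measurable
  have P0: "0 \<le> P l k t" and P1: "P l k t \<le> 1" for l k t
    unfolding P_def by (auto intro!: prod_nonneg prod_le_1)
  have intP: "integrable \<sigma> (P l k)" for l k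
    by (rule integrable_bounded[of _ 1]) (use P0 P1 in auto)
  have lower: "1 - \<delta> l \<le> (\<integral>t. P l k t \<partial>\<sigma>)" for l k
  proof -
    let ?X = "C \<inter> {l<..k}"
    have "2 ^ card ?X * (1 - \<delta> l) = (\<Sum>G\<in>Pow ?X. 1 - \<delta> l)" by (simp add: card_Pow del: Pow_Int_eq)
    also have "\<dots> \<le> (\<Sum>G\<in>Pow ?X. \<integral>t. cos (2 * pi * real (\<Sum>G) * t) \<partial>\<sigma>)"
    proof (intro sum_mono rigid subset_sumsI)
      fix G assume "G \<in> Pow ?X"
      then show "finite G" "G \<subseteq> C \<inter> {l<..}" by (auto intro: finite_subset[of _ "{l<..k}"])
    qed
    also have "\<dots> = (\<integral>t. (\<Sum>G\<in>Pow ?X. cos (2 * pi * real (\<Sum>G) * t)) \<partial>\<sigma>)"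
      by (rule Bochner_Integration.integral_sum[symmetric]) (rule integrable_cos)
    also have "\<dots> \<le> (\<integral>t. 2 ^ card ?X * P l k t \<partial>\<sigma>)"
      unfolding P_def
      by (intro integral_mono Bochner_Integration.integrable_sum integrable_cos
          integrable_mult_right sum_cos_subset_sums_le intP[unfolded P_def]) auto
    finally show ?thesis by simp
  qed
  have lim: "(\<lambda>k. P l k t) \<longlonglongrightarrow> 0" if t: "t \<notin> U" for l t
  proof -
    define S where "S k = (\<Sum>c\<in>C \<inter> {l<..k}. (nint_dist (real c * t))\<^sup>2)" for k
    have mono: "S k \<le> S k'" if "k \<le> k'" for k k'
      unfolding S_def by (rule sum_mono2) (use that in auto)
    have "\<exists>k. B \<le> S k" for B
    proof (rule ccontr)
      assume "\<not> (\<exists>k. B \<le> S k)"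
      then have B: "S k \<le> B" for k by (meson linear)
      have "sum (\<lambda>c. (nint_dist (real c * t))\<^sup>2) F \<le> B" if F: "finite F" "F \<subseteq> C \<inter> {l<..}" for F
      proof -
        \<comment> \<open>\<open>\<Sum>F\<close> serves as an upper bound for the elements of \<open>F\<close>.\<close>
        have "sum (\<lambda>c. (nint_dist (real c * t))\<^sup>2) F \<le> S (\<Sum>F)"
          unfolding S_def
          by (rule sum_mono2) (use F member_le_sum[of _ F "\<lambda>x. x"] in auto)
        then show ?thesis using B order_trans by blast
      qed
      then have "(\<lambda>c. (nint_dist (real c * t))\<^sup>2) summable_on C \<inter> {l<..}"
        by (intro nonneg_bounded_partial_sums_imp_summable_on[of _ _ B])
          (auto intro!: eventually_finite_subsets_at_top_weakI)
      then show False using t summable_on_tail_imp U_def by blast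
    qed
    then have "filterlim S at_top sequentially"
      unfolding filterlim_at_top eventually_sequentially using mono order_trans by metis
    then have "(\<lambda>k. exp (- S k)) \<longlonglongrightarrow> 0"
      by (intro filterlim_compose[OF exp_at_bot] filterlim_compose[OF filterlim_uminus_at_bot_at_top])
    moreover have "P l k t \<le> exp (- S k)" for k
    proof -
      have "P l k t \<le> (\<Prod>c\<in>C \<inter> {l<..k}. exp (- (nint_dist (real c * t))\<^sup>2))"
        unfolding P_def by (intro prod_mono) (auto intro: abs_cos_pi_le)
      also have "\<dots> = exp (- S k)" by (simp add: S_def exp_sum sum_negf[symmetric])
      finally show ?thesis .
    qed
    ultimately show ?thesis
      using P0 by (intro tendsto_sandwich[of "\<lambda>_. 0" "\<lambda>k. P l k t" sequentially "\<lambda>k. exp (- S k)"]) auto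
  qed
  have "1 - \<delta> l \<le> measure \<sigma> U" for l
  proof -
    have "(\<lambda>k. \<integral>t. indicator (- U) t * P l k t \<partial>\<sigma>) \<longlonglongrightarrow> (\<integral>t. 0 \<partial>\<sigma>)"
    proof (rule integral_dominated_convergence[where w = "\<lambda>_. 1"])
      show "AE t in \<sigma>. (\<lambda>k. indicator (- U) t * P l k t) \<longlonglongrightarrow> 0"
        using lim by (auto simp: indicator_def)
      show "AE t in \<sigma>. norm (indicator (- U) t * P l k t) \<le> 1" for k
        using P0 P1 by (auto simp: indicator_def)
    qed auto
    then have "(\<lambda>k. (\<integral>t. indicator (- U) t * P l k t \<partial>\<sigma>) + measure \<sigma> U) \<longlonglongrightarrow> 0 + measure \<sigma> U"
      by (intro tendsto_add) auto
    moreover have "1 - \<delta> l \<le> (\<integral>t. indicator (- U) t * P l k t \<partial>\<sigma>) + measure \<sigma> U" for k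
    proof -
      have i1: "integrable \<sigma> (\<lambda>t. indicator (- U) t * P l k t)"
        by (rule integrable_bounded[of _ 1]) (use P0 P1 in \<open>auto simp: indicator_def\<close>)
      have i2: "integrable \<sigma> (indicator U :: real \<Rightarrow> real)"
        by (rule integrable_bounded[of "indicator U" 1]) (auto simp: indicator_def)
      have "(\<integral>t. P l k t \<partial>\<sigma>) \<le> (\<integral>t. indicator (- U) t * P l k t + indicator U t \<partial>\<sigma>)"
        by (intro integral_mono intP Bochner_Integration.integrable_add i1 i2)
          (use P1 in \<open>auto simp: indicator_def\<close>)
      also have "\<dots> = (\<integral>t. indicator (- U) t * P l k t \<partial>\<sigma>) + measure \<sigma> U"
        using i1 i2 by simp
      finally show ?thesis using lower[of l k] by simp
    qed
    ultimately show ?thesis by (simp add: LIMSEQ_le_const)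
  qed
  then have "1 - 0 \<le> measure \<sigma> U"
    by (intro LIMSEQ_le_const2[OF tendsto_diff[OF tendsto_const \<delta>_tendsto]]) auto
  then have "measure \<sigma> U = 1" using prob_le_1[of U] by linarith
  then show ?thesis by (simp add: prob_eq_1)
qed

text \<open>
  Let \<open>D n\<close> be the cosine coefficients of the part of \<open>\<sigma>\<close> without atoms, which is carried by \<open>V\<close>.
  By Wiener's lemma the mean of the \<open>(D n)\<^sup>2\<close> tends to zero: it is the integral of the function \<open>h N\<close>,
  which in turn is the integral of the kernel \<open>K N\<close>, and \<open>K N u\<close> tends to zero unless \<open>u\<close> is
  congruent to \<open>t\<close> or \<open>- t\<close> modulo \<open>1\<close>.  If \<open>V\<close> had mass \<open>s > 0\<close>, rigidity would give \<open>D n \<ge> s / 2\<close>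
  for all subset sums \<open>n\<close> of some tail, and these have positive lower density.
\<close>

lemma AE_atom_of_gaps:
  assumes gaps: "\<And>l. \<exists>M. has_gaps_at_most M (subset_sums (C \<inter> {l<..}))"
  shows "AE t in \<sigma>. t \<in> {x. measure \<sigma> {x} \<noteq> 0}"
proof -
  define V where "V = {x. measure \<sigma> {x} = 0}"
  have "V = - {x. measure \<sigma> {x} \<noteq> 0}" by (auto simp: V_def)
  moreover have "{x. measure \<sigma> {x} \<noteq> 0} \<in> sets borel"
    by (rule sets.countable) (auto simp: countable_support)
  ultimately have [measurable]: "V \<in> sets borel" by simp
  define D where "D n = (\<integral>t. indicator V t * cos (2 * pi * real n * t) \<partial>\<sigma>)" for n
  have D_le: "\<bar>D n\<bar> \<le> 1" for n
  proof -
    have "norm (D n) \<le> (\<integral>t. 1 \<partial>\<sigma>)"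
      unfolding D_def
      by (intro Bochner_Integration.integral_norm_bound_integral integrable_bounded[of _ 1])
        (auto simp: indicator_def)
    also have "\<dots> = 1" using prob_space by simp
    finally show ?thesis by simp
  qed
  define h where "h N t = (\<Sum>n<N. D n * cos (2 * pi * real n * t)) / real N" for N t
  have h_le: "\<bar>h N t\<bar> \<le> 1" for N t
  proof -
    have "\<bar>\<Sum>n<N. D n * cos (2 * pi * real n * t)\<bar> \<le> (\<Sum>n<N. 1)"
      by (rule order_trans[OF sum_abs], rule sum_mono)
        (use D_le in \<open>auto simp: abs_mult intro!: mult_le_one\<close>)
    then show ?thesis by (cases "N = 0") (auto simp: h_def)
  qed
  have h_lim: "(\<lambda>N. h N t) \<longlonglongrightarrow> 0" for t
  proof -
    define K where "K N u = (\<Sum>n<N. cos (2 * pi * real n * u) * cos (2 * pi * real n * t)) / real N" for N u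
    have K_le: "\<bar>K N u\<bar> \<le> 1" for N u
    proof -
      have "\<bar>\<Sum>n<N. cos (2 * pi * real n * u) * cos (2 * pi * real n * t)\<bar> \<le> (\<Sum>n<N. 1)"
        by (rule order_trans[OF sum_abs], rule sum_mono)
          (auto simp: abs_mult intro!: mult_le_one)
      then show ?thesis by (cases "N = 0") (auto simp: K_def)
    qed
    have hK: "h N t = (\<integral>u. indicator V u * K N u \<partial>\<sigma>)" for N
    proof -
      have i: "integrable \<sigma> (\<lambda>u. indicator V u * cos (2 * pi * real n * u))" for n
        by (rule integrable_bounded[of _ 1]) (auto simp: indicator_def)
      have "h N t = (\<Sum>n<N. \<integral>u. indicator V u * cos (2 * pi * real n * u) * (cos (2 * pi * real n * t) / real N) \<partial>\<sigma>)"
        by (simp add: h_def D_def sum_divide_distrib)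
      also have "\<dots> = (\<integral>u. (\<Sum>n<N. indicator V u * cos (2 * pi * real n * u) * (cos (2 * pi * real n * t) / real N)) \<partial>\<sigma>)"
        by (rule Bochner_Integration.integral_sum[symmetric]) (use i in auto)
      also have "\<dots> = (\<integral>u. indicator V u * K N u \<partial>\<sigma>)"
        by (intro Bochner_Integration.integral_cong)
          (auto simp: K_def sum_distrib_left sum_divide_distrib mult.assoc)
      finally show ?thesis .
    qed
    \<comment> \<open>The exceptional set is countable and contains no atom, so it is null.\<close>
    define W where "W = (range (\<lambda>k::int. t + of_int k) \<union> range (\<lambda>k::int. - t + of_int k)) \<inter> V"
    have "countable W" unfolding W_def by auto
    then have "(\<Union>u\<in>W. {u}) \<in> null_sets \<sigma>"
      by (intro null_sets_UN') (auto simp: W_def V_def null_sets_def emeasure_eq_measure)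
    then have W: "AE u in \<sigma>. u \<notin> W" using AE_not_in by fastforce
    have "(\<lambda>N. K N u) \<longlonglongrightarrow> 0" if "u \<in> V" "u \<notin> W" for u
    proof -
      have "u - t \<notin> \<int>"
      proof
        assume "u - t \<in> \<int>"
        then obtain k where "u - t = of_int k" by (auto elim: Ints_cases)
        then have "u = t + of_int k" by simp
        then show False using that by (auto simp: W_def)
      qed
      moreover have "u + t \<notin> \<int>"
      proof
        assume "u + t \<in> \<int>"
        then obtain k where "u + t = of_int k" by (auto elim: Ints_cases)
        then have "u = - t + of_int k" by simp
        then show False using that by (auto simp: W_def)
      qed
      ultimately have "(\<lambda>N. ((\<Sum>n<N. cos (2 * pi * real n * (u - t))) / real N
          + (\<Sum>n<N. cos (2 * pi * real n * (u + t))) / real N) / 2) \<longlonglongrightarrow> (0 + 0) / 2"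
        by (intro tendsto_divide tendsto_add cos_average_tendsto_0) auto
      moreover have "K N u = ((\<Sum>n<N. cos (2 * pi * real n * (u - t))) / real N
          + (\<Sum>n<N. cos (2 * pi * real n * (u + t))) / real N) / 2" for N
      proof -
        have "cos (2 * pi * real n * u) * cos (2 * pi * real n * t)
            = (cos (2 * pi * real n * (u - t)) + cos (2 * pi * real n * (u + t))) / 2" for n
          by (simp add: right_diff_distrib distrib_left cos_add cos_diff)
        then have "K N u = (\<Sum>n<N. cos (2 * pi * real n * (u - t)) + cos (2 * pi * real n * (u + t))) / 2 / real N"
          unfolding K_def sum_divide_distrib[of _ _ 2] by (simp only:)
        then show ?thesis by (simp add: sum.distrib add_divide_distrib)
      qed
      ultimately show ?thesis by (simp only: add_0_left div_0)
    qed
    then have pw: "AE u in \<sigma>. (\<lambda>N. indicator V u * K N u) \<longlonglongrightarrow> 0"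
      using W by (auto elim!: eventually_mono simp: indicator_def)
    have [measurable]: "K N \<in> borel_measurable borel" for N
      unfolding K_def by measurable
    have "(\<lambda>N. \<integral>u. indicator V u * K N u \<partial>\<sigma>) \<longlonglongrightarrow> (\<integral>u. 0 \<partial>\<sigma>)"
      by (rule integral_dominated_convergence[where w = "\<lambda>_. 1", OF _ _ _ pw])
        (auto simp: indicator_def K_le)
    then show ?thesis unfolding hK by simp
  qed
  have [measurable]: "h N \<in> borel_measurable borel" for N
    unfolding h_def by measurable
  have "(\<lambda>N. \<integral>t. indicator V t * h N t \<partial>\<sigma>) \<longlonglongrightarrow> (\<integral>t. 0 \<partial>\<sigma>)"
    by (rule integral_dominated_convergence[where w = "\<lambda>_. 1"])
      (auto simp: indicator_def h_le h_lim)
  moreover have "(\<integral>t. indicator V t * h N t \<partial>\<sigma>) = (\<Sum>n<N. (D n)\<^sup>2) / real N" for N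
  proof -
    have i: "integrable \<sigma> (\<lambda>u. indicator V u * cos (2 * pi * real n * u))" for n
      by (rule integrable_bounded[of _ 1]) (auto simp: indicator_def)
    have "(\<integral>t. indicator V t * h N t \<partial>\<sigma>)
        = (\<integral>t. (\<Sum>n<N. indicator V t * cos (2 * pi * real n * t) * (D n / real N)) \<partial>\<sigma>)"
      by (intro Bochner_Integration.integral_cong)
        (auto simp: h_def sum_distrib_left sum_divide_distrib mult_ac)
    also have "\<dots> = (\<Sum>n<N. \<integral>t. indicator V t * cos (2 * pi * real n * t) * (D n / real N) \<partial>\<sigma>)"
      by (rule Bochner_Integration.integral_sum) (use i in auto)
    also have "\<dots> = (\<Sum>n<N. (D n)\<^sup>2) / real N"
      by (simp add: D_def[symmetric] sum_divide_distrib power2_eq_square)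
    finally show ?thesis .
  qed
  ultimately have wiener: "(\<lambda>N. (\<Sum>n<N. (D n)\<^sup>2) / real N) \<longlonglongrightarrow> 0" by simp
  have "measure \<sigma> V = 0"
  proof (rule ccontr)
    define s where "s = measure \<sigma> V"
    assume "measure \<sigma> V \<noteq> 0"
    then have s: "0 < s" by (simp add: s_def zero_less_measure_iff)
    then obtain l where l: "\<delta> l < s / 2"
      using order_tendstoD(2)[OF \<delta>_tendsto, of "s / 2"] by (auto simp: eventually_sequentially)
    obtain M where M: "has_gaps_at_most M (subset_sums (C \<inter> {l<..}))" using gaps by blast
    have M0: "0 < M" using M by (rule has_gaps_at_most_pos)
    define R where "R N = subset_sums (C \<inter> {l<..}) \<inter> {..<N}" for N
    have [simp]: "finite (R N)" for N by (simp add: R_def)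
    have card: "real N \<le> real (card (R N)) * real M" for N
      using has_gaps_at_most_card[OF M, of N] unfolding R_def by (metis of_nat_le_iff of_nat_mult)
    have low: "s\<^sup>2 / (4 * real M) \<le> (\<Sum>n<N. (D n)\<^sup>2) / real N" if N: "0 < N" for N
    proof -
      have "real N * (s / 2)\<^sup>2 \<le> real M * (real (card (R N)) * (s / 2)\<^sup>2)"
        using mult_right_mono[OF card[of N], of "(s / 2)\<^sup>2"] by (simp add: mult_ac)
      also have "real (card (R N)) * (s / 2)\<^sup>2 \<le> (\<Sum>n\<in>R N. (D n)\<^sup>2)"
      proof (rule sum_bounded_below)
        fix n assume "n \<in> R N"
        then have "s - D n \<le> \<delta> l"
          unfolding s_def D_def R_def by (intro indicator_cos_defect_le) auto
        then show "(s / 2)\<^sup>2 \<le> (D n)\<^sup>2" using l s by (intro power_mono) auto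
      qed
      also have "(\<Sum>n\<in>R N. (D n)\<^sup>2) \<le> (\<Sum>n<N. (D n)\<^sup>2)"
        by (rule sum_mono2) (auto simp: R_def)
      finally show ?thesis using N M0 by (simp add: field_simps power2_eq_square)
    qed
    have "s\<^sup>2 / (4 * real M) \<le> 0"
      by (rule LIMSEQ_le_const[OF wiener]) (use low in \<open>auto intro!: exI[of _ 1]\<close>)
    then show False using s M0 by (simp add: divide_le_0_iff)
  qed
  then have "V \<in> null_sets \<sigma>" by (simp add: null_sets_def emeasure_eq_measure)
  then have "AE t in \<sigma>. t \<notin> V" by (rule AE_not_in)
  then show ?thesis by (simp add: V_def)
qed

end

section \<open>Upper density\<close>

text \<open>
  The limit superior of \<open>card (X \<inter> {..<N}) / N\<close>, as a real number.  The infimum of eventual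
  upper bounds gives directly the two estimates in the lemmas
  \<open>eventually_card_le_of_upper_density_less\<close> and \<open>frequently_card_gt_of_less_upper_density\<close>.
\<close>

definition upper_density :: "nat set \<Rightarrow> real" where
  "upper_density X = Inf {u. \<forall>\<^sub>F N in sequentially. real (card (X \<inter> {..<N})) \<le> u * real N}"

lemma upper_density_bound_mem:
  "1 \<in> {u. \<forall>\<^sub>F N in sequentially. real (card (X \<inter> {..<N})) \<le> u * real N}"
proof -
  have "card (X \<inter> {..<N}) \<le> card {..<N}" for N by (intro card_mono) auto
  then show ?thesis by simp
qed

lemma upper_density_bdd_below:
  "bdd_below {u. \<forall>\<^sub>F N in sequentially. real (card (X \<inter> {..<N})) \<le> u * real N}"
proof (rule bdd_belowI[of _ 0])
  fix u assume "u \<in> {u. \<forall>\<^sub>F N in sequentially. real (card (X \<inter> {..<N})) \<le> u * real N}"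
  then have "\<forall>\<^sub>F N in sequentially. real (card (X \<inter> {..<N})) \<le> u * real N \<and> 0 < N"
    using eventually_gt_at_top[of 0] by (simp add: eventually_conj_iff)
  then obtain N where N: "real (card (X \<inter> {..<N})) \<le> u * real N" "0 < N"
    using eventually_happens'[OF sequentially_bot] by blast
  then have "0 \<le> u * real N" by (meson of_nat_0_le_iff order_trans)
  then show "0 \<le> u" using N by (simp add: zero_le_mult_iff)
qed

lemma eventually_card_le_of_upper_density_less:
  assumes "upper_density X < u"
  shows "\<forall>\<^sub>F N in sequentially. real (card (X \<inter> {..<N})) \<le> u * real N"
proof -
  obtain v where v: "\<forall>\<^sub>F N in sequentially. real (card (X \<inter> {..<N})) \<le> v * real N" "v < u"
    using cInf_lessD[OF _ assms[unfolded upper_density_def]] upper_density_bound_mem by blast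
  from v(1) show ?thesis
    by eventually_elim (use v(2) in \<open>meson less_imp_le mult_right_mono of_nat_0_le_iff order_trans\<close>)
qed

lemma frequently_card_gt_of_less_upper_density:
  assumes "v < upper_density X"
  shows "\<exists>\<^sub>F N in sequentially. v * real N < real (card (X \<inter> {..<N}))"
proof (rule ccontr)
  assume "\<not> ?thesis"
  then have "\<forall>\<^sub>F N in sequentially. real (card (X \<inter> {..<N})) \<le> v * real N"
    by (simp add: not_frequently not_less)
  then have "upper_density X \<le> v"
    unfolding upper_density_def by (intro cInf_lower upper_density_bdd_below) simp
  then show False using assms by simp
qed

lemma upper_density_mono:
  assumes "X \<subseteq> Y"
  shows "upper_density X \<le> upper_density Y"
proof -
  have "card (X \<inter> {..<N}) \<le> card (Y \<inter> {..<N})" for N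
    by (intro card_mono) (use assms in auto)
  then have "real (card (X \<inter> {..<N})) \<le> u" if "real (card (Y \<inter> {..<N})) \<le> u" for N u
    using that by (meson of_nat_mono order_trans)
  then show ?thesis
    unfolding upper_density_def
  proof (intro cInf_superset_mono upper_density_bdd_below)
    show "{u. \<forall>\<^sub>F N in sequentially. real (card (Y \<inter> {..<N})) \<le> u * real N} \<noteq> {}"
      using upper_density_bound_mem by blast
  qed (auto elim!: eventually_mono)
qed

lemma upper_density_pos_of_gaps:
  assumes "has_gaps_at_most M S"
  shows "0 < upper_density S"
proof -
  have M: "0 < M" using assms by (rule has_gaps_at_most_pos)
  have "1 / real M \<le> upper_density S"
  proof (rule ccontr)
    assume "\<not> 1 / real M \<le> upper_density S"
    then obtain u where u: "upper_density S < u" "u < 1 / real M" by (meson dense not_le)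
    have "\<forall>\<^sub>F N in sequentially. real (card (S \<inter> {..<N})) \<le> u * real N \<and> 0 < N"
      using eventually_card_le_of_upper_density_less[OF u(1)] eventually_gt_at_top[of 0]
      by (simp add: eventually_conj_iff)
    then obtain N where N: "real (card (S \<inter> {..<N})) \<le> u * real N" "0 < N"
      using eventually_happens'[OF sequentially_bot] by blast
    have "real N \<le> real (card (S \<inter> {..<N})) * real M"
      using has_gaps_at_most_card[OF assms, of N] by (metis of_nat_le_iff of_nat_mult)
    also have "\<dots> \<le> u * real N * real M" using N by (intro mult_right_mono) auto
    also have "\<dots> = (u * real M) * real N" by simp
    also have "\<dots> < 1 * real N"
      using u M N by (intro mult_strict_right_mono) (auto simp: field_simps)
    finally show False by simp
  qed
  then show ?thesis using M by (meson divide_pos_pos less_le_trans of_nat_0_less_iff zero_less_one)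
qed


section \<open>Long intervals in sumsets, and completeness\<close>

text \<open>
  Inclusion and exclusion for \<open>A\<close> and its translate by \<open>n\<close> inside \<open>X \<inter> {..<N + n}\<close>.
\<close>

lemma card_translate_overlap:
  fixes A X :: "nat set"
  assumes A: "A \<subseteq> X \<inter> {..<N}" and shift: "\<And>x. x \<in> A \<Longrightarrow> x + n \<in> X"
  shows "2 * card A \<le> card {x\<in>A. x + n \<in> A} + card (X \<inter> {..<N}) + n"
proof -
  have fin: "finite A" using A finite_subset by blast
  let ?B = "(\<lambda>x. x + n) ` A"
  have cB: "card ?B = card A" by (intro card_image) auto
  have "?B \<inter> A = (\<lambda>x. x + n) ` {x\<in>A. x + n \<in> A}" by auto
  then have cI: "card (?B \<inter> A) = card {x\<in>A. x + n \<in> A}" by (simp add: card_image)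
  have "?B \<union> A \<subseteq> (X \<inter> {..<N}) \<union> {N..<N + n}" using A shift by auto
  then have "card (?B \<union> A) \<le> card ((X \<inter> {..<N}) \<union> {N..<N + n})" by (intro card_mono) auto
  also have "\<dots> \<le> card (X \<inter> {..<N}) + card {N..<N + n}" by (rule card_Un_le)
  finally show ?thesis using card_Un_Int[of ?B A] fin cB cI by simp
qed

text \<open>
  For each \<open>j < L\<close> fewer than \<open>card A / (L + 1)\<close> points of \<open>A\<close> leave \<open>A\<close> under translation
  by \<open>j\<close>, so some point stays in \<open>A\<close> under all of them.
\<close>

lemma long_run_of_autocorrelation:
  assumes fin: "finite A" and ne: "A \<noteq> {}"
    and close: "\<And>j. j < L \<Longrightarrow> 1 - 1 / real (Suc L) < autocorrelation A j"
  obtains x where "{x..<x + L} \<subseteq> A"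
proof -
  have a: "0 < real (card A)" using fin ne by (simp add: card_gt_0_iff)
  have bad: "real (card {x\<in>A. x + j \<notin> A}) \<le> real (card A) / real (Suc L)" if "j < L" for j
  proof -
    have "card A = card {x\<in>A. x + j \<in> A} + card {x\<in>A. x + j \<notin> A}"
      by (subst card_Un_disjoint[symmetric]) (auto simp: fin intro!: arg_cong[of _ _ card])
    then have "real (card {x\<in>A. x + j \<notin> A}) = real (card A) * (1 - autocorrelation A j)"
      using a by (simp add: autocorrelation_def field_simps)
    also have "\<dots> \<le> real (card A) * (1 / real (Suc L))"
      using close[OF that] a by (intro mult_left_mono) auto
    finally show ?thesis by simp
  qed
  have "real (card (\<Union>j<L. {x\<in>A. x + j \<notin> A})) \<le> (\<Sum>j<L. real (card {x\<in>A. x + j \<notin> A}))"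
    unfolding of_nat_sum[symmetric] of_nat_le_iff by (rule card_UN_le) simp
  also have "\<dots> \<le> (\<Sum>j<L. real (card A) / real (Suc L))" by (intro sum_mono bad) simp
  also have "\<dots> = real L * (real (card A) / real (Suc L))" by simp
  also have "\<dots> < real (card A)" using a by (simp add: field_simps)
  finally have "card (\<Union>j<L. {x\<in>A. x + j \<notin> A}) < card A" by simp
  moreover have "finite (\<Union>j<L. {x\<in>A. x + j \<notin> A})" using fin by auto
  ultimately have "\<not> A \<subseteq> (\<Union>j<L. {x\<in>A. x + j \<notin> A})"
    using card_mono leD by blast
  then obtain x where x: "x \<in> A" "\<forall>j<L. x + j \<in> A" by blast
  have "{x..<x + L} \<subseteq> A"
  proof
    fix y assume "y \<in> {x..<x + L}"
    then have "y = x + (y - x)" "y - x < L" by auto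
    then show "y \<in> A" using x(2) by metis
  qed
  then show thesis using that by blast
qed

text \<open>
  The limit spectral measure of the sets \<open>A k\<close> is rigid with defects \<open>d l / D - 1\<close>, so it is carried
  by the integers, and the autocorrelations of \<open>A k\<close> tend to \<open>1\<close> along a subsequence.
\<close>

lemma long_intervals_in_sumset:
  fixes S C :: "nat set"
  assumes S: "0 < upper_density S"
    and triv: "\<And>x. (\<lambda>c. nint_dist (real c * x)) summable_on C \<Longrightarrow> x \<in> \<int>"
    and alt: "(\<forall>l. \<exists>M. has_gaps_at_most M (subset_sums (C \<inter> {l<..}))) \<or>
      countable {x. (\<lambda>c. (nint_dist (real c * x))\<^sup>2) summable_on C}"
  obtains x where "{x..<x + L} \<subseteq> {s + f | s f. s \<in> S \<and> f \<in> subset_sums (C \<inter> {l<..})}"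
proof -
  define E where "E l = {s + f | s f. s \<in> S \<and> f \<in> subset_sums (C \<inter> {l<..})}" for l
  have S_sub: "S \<subseteq> E l" for l
    unfolding E_def using zero_in_subset_sums by force
  have E_anti: "E k \<subseteq> E l" if "l \<le> k" for k l
    unfolding E_def using subset_sums_mono[of "C \<inter> {k<..}" "C \<inter> {l<..}"] that by fastforce
  have E_add: "x + n \<in> E l" if x: "x \<in> E k" and n: "n \<in> subset_sums (C \<inter> {l<..k})" and lk: "l \<le> k" for x n k l
  proof -
    obtain s f where sf: "x = s + f" "s \<in> S" "f \<in> subset_sums (C \<inter> {k<..})"
      using x unfolding E_def by blast
    have "f + n \<in> subset_sums (C \<inter> {k<..} \<union> C \<inter> {l<..k})"
      by (intro add_in_subset_sums sf n) auto
    moreover have "C \<inter> {k<..} \<union> C \<inter> {l<..k} = C \<inter> {l<..}" using lk by auto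
    ultimately show ?thesis using sf unfolding E_def by (auto simp: add.assoc)
  qed
  define d where "d l = upper_density (E l)" for l
  have "decseq d"
    unfolding d_def by (intro decseq_SucI upper_density_mono E_anti) simp
  moreover have "upper_density S \<le> d l" for l
    unfolding d_def by (intro upper_density_mono S_sub)
  ultimately obtain D where D: "d \<longlonglongrightarrow> D" "\<And>l. D \<le> d l"
    using decseq_convergent by blast
  have "upper_density S \<le> D"
    by (rule LIMSEQ_le_const[OF D(1)]) (use \<open>\<And>l. upper_density S \<le> d l\<close> in auto)
  then have D0: "0 < D" using S by simp
  \<comment> \<open>The tolerance stays below \<open>D\<close>, so that every \<open>A k\<close> is nonempty.\<close>
  define \<eta> where "\<eta> k = D / real (k + 2)" for k
  have \<eta>0: "0 < \<eta> k" and \<eta>D: "\<eta> k < D" for k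
    using D0 by (auto simp: \<eta>_def field_simps intro: add_pos_nonneg)
  have "\<exists>N. k < N \<and> (\<forall>l\<in>{..k}. real (card (E l \<inter> {..<N})) \<le> (d l + \<eta> k) * real N) \<and>
      (d k - \<eta> k) * real N < real (card (E k \<inter> {..<N}))" for k
  proof -
    have "\<forall>\<^sub>F N in sequentially. \<forall>l\<in>{..k}. real (card (E l \<inter> {..<N})) \<le> (d l + \<eta> k) * real N"
      by (intro eventually_ball_finite ballI eventually_card_le_of_upper_density_less)
        (use \<eta>0 in \<open>auto simp: d_def\<close>)
    then have "\<forall>\<^sub>F N in sequentially. k < N \<and>
        (\<forall>l\<in>{..k}. real (card (E l \<inter> {..<N})) \<le> (d l + \<eta> k) * real N)"
      using eventually_gt_at_top by (intro eventually_conj) auto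
    moreover have "\<exists>\<^sub>F N in sequentially. (d k - \<eta> k) * real N < real (card (E k \<inter> {..<N}))"
      by (intro frequently_card_gt_of_less_upper_density) (use \<eta>0 in \<open>auto simp: d_def\<close>)
    ultimately show ?thesis
      using frequently_eventually_frequently frequently_ex by (smt (verit, best))
  qed
  then obtain N where N: "\<And>k. k < N k"
      "\<And>k l. l \<le> k \<Longrightarrow> real (card (E l \<inter> {..<N k})) \<le> (d l + \<eta> k) * real (N k)"
      "\<And>k. (d k - \<eta> k) * real (N k) < real (card (E k \<inter> {..<N k}))"
    by (metis atMost_iff)
  define A where "A k = E k \<inter> {..<N k}" for k
  have A_fin: "finite (A k)" for k by (simp add: A_def)
  have A_card: "(D - \<eta> k) * real (N k) < real (card (A k))" for k
  proof -
    have "(D - \<eta> k) * real (N k) \<le> (d k - \<eta> k) * real (N k)"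
      using D(2)[of k] by (intro mult_right_mono) auto
    then show ?thesis using N(3)[of k] by (simp add: A_def)
  qed
  have A_pos: "0 < real (card (A k))" for k
  proof -
    have "0 \<le> (D - \<eta> k) * real (N k)" using \<eta>D[of k] by simp
    then show ?thesis using A_card[of k] by linarith
  qed
  have A_ne: "A k \<noteq> {}" for k using A_pos[of k] by auto
  obtain r \<sigma> where r: "strict_mono r" and \<sigma>: "real_distribution \<sigma>"
    and lim: "\<And>n. (\<lambda>k. autocorrelation (A (r k)) n) \<longlonglongrightarrow> (\<integral>t. cos (2 * pi * real n * t) \<partial>\<sigma>)"
    by (rule limit_spectral_measure[of A, OF A_fin A_ne]) metis
  have rigid: "1 - (d l / D - 1) \<le> (\<integral>t. cos (2 * pi * real n * t) \<partial>\<sigma>)"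
    if n: "n \<in> subset_sums (C \<inter> {l<..})" for n l
  proof -
    obtain F where F: "finite F" "F \<subseteq> C \<inter> {l<..}" "n = \<Sum>F"
      using n by (rule subset_sumsE)
    \<comment> \<open>The term \<open>n / Suc k\<close> pays for the at most \<open>n\<close> points that the translate has beyond \<open>N k > k\<close>.\<close>
    define b where "b k = 2 - (d l + \<eta> k + real n / real (Suc k)) / (D - \<eta> k)" for k
    have b_le: "b k \<le> autocorrelation (A k) n" if k: "l \<le> k" "n \<le> k" for k
    proof -
      have "F \<subseteq> C \<inter> {l<..k}"
        using F k(2) member_le_sum[of _ F "\<lambda>x. x"] by fastforce
      then have n': "n \<in> subset_sums (C \<inter> {l<..k})" using F by (auto intro: subset_sumsI)
      have "2 * card (A k) \<le> card {x\<in>A k. x + n \<in> A k} + card (E l \<inter> {..<N k}) + n"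
        by (rule card_translate_overlap)
          (use E_anti[OF k(1)] E_add[OF _ n' k(1)] in \<open>auto simp: A_def\<close>)
      then have "2 * real (card (A k)) - (real (card (E l \<inter> {..<N k})) + real n)
          \<le> real (card {x\<in>A k. x + n \<in> A k})" by linarith
      moreover have "real (card (E l \<inter> {..<N k})) + real n \<le>
          (d l + \<eta> k + real n / real (Suc k)) * real (N k)"
      proof -
        have "real n = real n / real (Suc k) * real (Suc k)" by simp
        also have "\<dots> \<le> real n / real (Suc k) * real (N k)"
          using N(1)[of k] by (intro mult_left_mono) auto
        finally show ?thesis using N(2)[OF k(1)] by (simp add: distrib_right)
      qed
      moreover have "(d l + \<eta> k + real n / real (Suc k)) * real (N k)
          \<le> (d l + \<eta> k + real n / real (Suc k)) / (D - \<eta> k) * real (card (A k))"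
      proof -
        let ?c = "(d l + \<eta> k + real n / real (Suc k)) / (D - \<eta> k)"
        have "0 \<le> ?c" using D(2)[of l] D0 \<eta>0[of k] \<eta>D[of k] by (intro divide_nonneg_nonneg) auto
        then have "?c * ((D - \<eta> k) * real (N k)) \<le> ?c * real (card (A k))"
          using A_card[of k] by (intro mult_left_mono) auto
        then show ?thesis using \<eta>D[of k] by simp
      qed
      ultimately have "b k * real (card (A k)) \<le> real (card {x\<in>A k. x + n \<in> A k})"
        unfolding b_def left_diff_distrib by linarith
      then show ?thesis
        using A_pos[of k] by (simp add: autocorrelation_def pos_le_divide_eq)
    qed
    have "b \<longlonglongrightarrow> 2 - (d l + 0 + 0) / (D - 0)"
    proof -
      have "\<eta> \<longlonglongrightarrow> 0" unfolding \<eta>_def by (rule LIMSEQ_ignore_initial_segment[OF lim_const_over_n])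
      moreover have "(\<lambda>k. real n / real (Suc k)) \<longlonglongrightarrow> 0" by (rule LIMSEQ_Suc[OF lim_const_over_n])
      ultimately show ?thesis
        unfolding b_def using D0 by (intro tendsto_intros) auto
    qed
    then have "(b \<circ> r) \<longlonglongrightarrow> 1 - (d l / D - 1)"
      using LIMSEQ_subseq_LIMSEQ[OF _ r] by simp
    then show ?thesis
    proof (rule LIMSEQ_le[OF _ lim[of n]], intro exI allI impI)
      fix k assume "l + n \<le> k"
      then have "l \<le> r k" "n \<le> r k" using seq_suble[OF r, of k] by auto
      then show "(b \<circ> r) k \<le> autocorrelation (A (r k)) n" using b_le by simp
    qed
  qed
  interpret real_distribution \<sigma> by (rule \<sigma>)
  interpret rigid_spectrum \<sigma> C "\<lambda>l. d l / D - 1"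
  proof
    have "(\<lambda>l. d l / D - 1) \<longlonglongrightarrow> D / D - 1"
      using D(1) D0 by (intro tendsto_intros) auto
    then show "(\<lambda>l. d l / D - 1) \<longlonglongrightarrow> 0" using D0 by simp
  qed (rule rigid)
  have "AE t in \<sigma>. t \<in> \<int>"
    using alt
  proof
    assume "\<forall>l. \<exists>M. has_gaps_at_most M (subset_sums (C \<inter> {l<..}))"
    then show ?thesis by (intro AE_Ints[OF countable_support AE_atom_of_gaps] triv) auto
  next
    assume "countable {x. (\<lambda>c. (nint_dist (real c * x))\<^sup>2) summable_on C}"
    then show ?thesis by (intro AE_Ints[OF _ AE_square_summable] triv) auto
  qed
  then have "AE t in \<sigma>. cos (2 * pi * real n * t) = 1" for n
  proof eventually_elim
    case (elim t)
    then have "real n * t \<in> \<int>" by (intro Ints_mult) auto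
    then show ?case by (metis cos_integer_2pi mult.assoc)
  qed
  then have "(\<integral>t. cos (2 * pi * real n * t) \<partial>\<sigma>) = (\<integral>t. 1 \<partial>\<sigma>)" for n
    by (intro integral_cong_AE) auto
  then have one: "(\<lambda>k. autocorrelation (A (r k)) n) \<longlonglongrightarrow> 1" for n
    using lim[of n] prob_space by simp
  have "\<forall>\<^sub>F k in sequentially. \<forall>j\<in>{..<L}. 1 - 1 / real (Suc L) < autocorrelation (A (r k)) j"
    by (intro eventually_ball_finite ballI order_tendstoD(1)[OF one]) auto
  then have "\<forall>\<^sub>F k in sequentially. (\<forall>j\<in>{..<L}. 1 - 1 / real (Suc L) < autocorrelation (A (r k)) j) \<and> l \<le> k"
    by (intro eventually_conj eventually_ge_at_top)
  then obtain k where k: "\<And>j. j < L \<Longrightarrow> 1 - 1 / real (Suc L) < autocorrelation (A (r k)) j" "l \<le> k"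
    using eventually_happens'[OF sequentially_bot] by blast
  obtain x where "{x..<x + L} \<subseteq> A (r k)"
    using long_run_of_autocorrelation[OF A_fin A_ne k(1)] by blast
  also have "A (r k) \<subseteq> E l"
    using E_anti[of l "r k"] seq_suble[OF r, of k] k(2) by (auto simp: A_def)
  finally show thesis using that unfolding E_def by blast
qed

text \<open>
  Given \<open>n \<ge> x\<close>, an element \<open>g\<close> of \<open>FS(B1 - D)\<close> brings \<open>n - g\<close> into the interval that starts at
  \<open>x\<close>.  Taking the tail of \<open>C\<close> beyond \<open>D\<close> keeps the removed elements out of the representation.
\<close>

theorem theorem2p2:
  fixes B1 B2 C :: "nat set"
  assumes "B1 \<subseteq> {1..}" and "B2 \<subseteq> {1..}" and "C \<subseteq> {1..}"
    and "infinite B1" and "infinite B2" and "infinite C"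
    and "B1 \<inter> B2 = {}" and "B1 \<inter> C = {}" and "B2 \<inter> C = {}"
    and "Delta B1 < \<infinity>" and "Delta B2 < \<infinity>"
    and "H 1 (int ` C) = {0}"
    and "Delta C < \<infinity> \<or> countable (H 2 (int ` C))"
  shows "strongly_complete (B1 \<union> B2 \<union> C)"
  unfolding strongly_complete_def
proof (intro allI impI, elim conjE)
  fix D :: "nat set" assume D: "finite D"
  have triv: "x \<in> \<int>" if "(\<lambda>c. nint_dist (real c * x)) summable_on C" for x
  proof -
    have "abs_circle x \<in> H 1 (int ` C)"
      using that by (simp add: abs_circle_in_H_iff nint_dist_nonneg)
    then show ?thesis using assms(12) by (simp add: abs_circle_eq_0_iff)
  qed
  have alt: "(\<forall>l. \<exists>M. has_gaps_at_most M (subset_sums (C \<inter> {l<..}))) \<or>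
      countable {x. (\<lambda>c. (nint_dist (real c * x))\<^sup>2) summable_on C}"
    using assms(13)
  proof
    assume fin: "Delta C < \<infinity>"
    have "\<exists>M. has_gaps_at_most M (subset_sums (C \<inter> {l<..}))" for l
    proof -
      have "C \<inter> {l<..} = C - {..l}" by auto
      then show ?thesis
        using gaps_subset_sums_diff[OF fin assms(6), of "{..l}"] by (metis finite_atMost)
    qed
    then show ?thesis by blast
  next
    assume "countable (H 2 (int ` C))"
    then have "countable (abs_circle -` H 2 (int ` C))" by (rule countable_vimage_abs_circle)
    moreover have "abs_circle -` H 2 (int ` C) = {x. (\<lambda>c. (nint_dist (real c * x))\<^sup>2) summable_on C}"
      by (auto simp: abs_circle_in_H_iff nint_dist_nonneg)
    ultimately show ?thesis by simp
  qed
  obtain M1 where M1: "has_gaps_at_most M1 (subset_sums (B1 - D))"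
    using gaps_subset_sums_diff assms(4,10) D by blast
  obtain M2 where M2: "has_gaps_at_most M2 (subset_sums (B2 - D))"
    using gaps_subset_sums_diff assms(5,11) D by blast
  obtain l where l: "D \<subseteq> {..l}" using D finite_nat_iff_bounded_le by blast
  obtain x where x: "{x..<x + M1} \<subseteq>
      {s + f | s f. s \<in> subset_sums (B2 - D) \<and> f \<in> subset_sums (C \<inter> {l<..})}"
    using long_intervals_in_sumset[OF upper_density_pos_of_gaps[OF M2] triv alt] by blast
  show "complete_set (B1 \<union> B2 \<union> C - D)"
    unfolding complete_set_def
  proof (intro exI[of _ x] allI impI)
    fix n assume n: "x \<le> n"
    obtain g where g: "g \<in> subset_sums (B1 - D)" "g \<le> n - x" "n - x < g + M1"
      using M1 by (rule has_gaps_at_mostE)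
    then have "n - g \<in> {x..<x + M1}" using n by auto
    then obtain s f where sf: "n - g = s + f" "s \<in> subset_sums (B2 - D)"
        "f \<in> subset_sums (C \<inter> {l<..})"
      using x by auto
    have "g + (s + f) \<in> subset_sums ((B1 - D) \<union> ((B2 - D) \<union> (C \<inter> {l<..})))"
      by (intro add_in_subset_sums g sf) (use assms(7-9) in auto)
    moreover have "g + (s + f) = n" using sf(1) g(2) n by simp
    moreover have "(B1 - D) \<union> ((B2 - D) \<union> (C \<inter> {l<..})) \<subseteq> B1 \<union> B2 \<union> C - D"
      using l by auto
    ultimately have "n \<in> subset_sums (B1 \<union> B2 \<union> C - D)" using subset_sums_mono by blast
    then show "\<exists>F. finite F \<and> F \<subseteq> B1 \<union> B2 \<union> C - D \<and> n = \<Sum>F"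
      by (rule subset_sumsE) blast
  qed
qed

end
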